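(* Let $1\le m\le n$ and let $\phi:\mathcal F(m,n)\to \mathrm{PF}(m,n)$ be the breadth first search bijection. For every forest $F\in\mathcal F(m,n)$ with corresponding parking function $\pi=\phi(F)$: (1) for every $i\in\{1,\dots,m\}$, the number of times $\pi_i$ appears in $\pi$, i.e. $\#\{k:\pi_k=\pi_i\}$, equals the degree of the parent of vertex $i$ in $F$; (2) for every $j\in\{1,\dots,n-m+1\}$, the number of times $j$ appears in $\pi$ equals the degree of the root vertex $0j$ in $F$. Consequently, these statistics on $\mathrm{PF}(m,n)$ and the respective statistics on $\mathcal F(m,n)$ are equidistributed.
   Context: $\mathrm{PF}(m,n)$ is the set of parking functions with $m$ cars and $n$ spots, i.e. sequences $\pi=(\pi_1,\dots,\pi_m)\in\{1,\dots,n\}^m$ with $\#\{k:\pi_k\le i\}\ge m-n+i$ for $i=n-m+1,\dots,n$. $\mathcal F(m,n)$ is the set of rooted forests with $n+1$ vertices and $m$ edges consisting of $n-m+1$ trees, whose roots are $n-m+1$ specified vertices labeled $01,02,\dots,0(n-m+1)$ and whose non-root vertices are labeled $1,\dots,m$. The degree of a vertex always means its number of children. The BFS order on the vertices of $F$: first the roots $01,02,\dots,0(n-m+1)$ in this order, then the vertices at distance $1$ from a root, then those at distance $2$, and so on; vertices at the same level are ordered according to the BFS position of their parents, and vertices with the same parent are ordered by increasing label. The map $\phi$, which is a bijection from $\mathcal F(m,n)$ to $\mathrm{PF}(m,n)$, sends $F$ to the sequence $\pi=(\pi_1,\dots,\pi_m)$ where $\pi_i$ is the position in the BFS order (counting all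 vertices, roots included, starting from position $1$) of the parent of vertex $i$. Thus $\pi_i=j$ if the parent of $i$ is the root $0j$, and $\pi_i=(n-m+1)+\sigma(v)$ if the parent of $i$ is a non-root vertex $v$ which is the $\sigma(v)$-th non-root vertex in BFS order. *)

theory Defs
  imports Main "HOL-Library.FuncSet"
begin

section \<open>Parking functions\<close>

text \<open>A sequence indexed by \<open>1, \<dots>, m\<close> is a function that is extensional on \<open>{1..m}\<close>. In the range
  of \<open>i\<close> considered, \<open>m - n + i \<ge> 1\<close>; it is written \<open>m + i - n\<close> so that the subtraction does not
  truncate.\<close>

definition parking_functions :: "nat \<Rightarrow> nat \<Rightarrow> (nat \<Rightarrow> nat) set" where
  "parking_functions m n =
     {\<pi> \<in> {1..m} \<rightarrow>\<^sub>E {1..n}.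
        \<forall>i\<in>{n - m + 1..n}. card {k \<in> {1..m}. \<pi> k \<le> i} \<ge> m + i - n}"

definition occurrences :: "nat \<Rightarrow> (nat \<Rightarrow> nat) \<Rightarrow> nat \<Rightarrow> nat" where
  "occurrences m \<pi> x = card {k \<in> {1..m}. \<pi> k = x}"


section \<open>Undirected graphs, given by their edge sets\<close>

definition adj :: "'a set set \<Rightarrow> ('a \<times> 'a) set" where
  "adj E = {(u, v). {u, v} \<in> E}"

definition is_cycle :: "'a set set \<Rightarrow> 'a list \<Rightarrow> bool" where
  "is_cycle E p \<longleftrightarrow> length p \<ge> 3 \<and> distinct p \<and>
     successively (\<lambda>u v. {u, v} \<in> E) p \<and> {last p, hd p} \<in> E"

definition graph_dist :: "'a set set \<Rightarrow> 'a \<Rightarrow> 'a \<Rightarrow> nat" where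
  "graph_dist E u v = (LEAST k. (u, v) \<in> adj E ^^ k)"


section \<open>Rooted forests\<close>

text \<open>\<open>Root j\<close> is the vertex labeled \<open>0j\<close>, and \<open>Node i\<close> is the non-root vertex labeled \<open>i\<close>.\<close>

datatype vertex = Root nat | Node nat

definition roots :: "nat \<Rightarrow> nat \<Rightarrow> vertex set" where
  "roots m n = Root ` {1..n - m + 1}"

definition vertices :: "nat \<Rightarrow> nat \<Rightarrow> vertex set" where
  "vertices m n = roots m n \<union> Node ` {1..m}"

text \<open>The vertex set is fixed, so a forest is identified with its edge set. The last condition says
  that each connected component contains exactly one of the specified roots; in particular there
  are \<open>n - m + 1\<close> components.\<close>

definition rooted_forests :: "nat \<Rightarrow> nat \<Rightarrow> vertex set set set" where
  "rooted_forests m n =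
     {F. F \<subseteq> {{u, v} | u v. u \<in> vertices m n \<and> v \<in> vertices m n \<and> u \<noteq> v} \<and>
         card F = m \<and>
         (\<nexists>p. is_cycle F p) \<and>
         (\<forall>v \<in> vertices m n. \<exists>!r. r \<in> roots m n \<and> (r, v) \<in> (adj F)\<^sup>*)}"

definition root_of :: "nat \<Rightarrow> nat \<Rightarrow> vertex set set \<Rightarrow> vertex \<Rightarrow> vertex" where
  "root_of m n F v = (THE r. r \<in> roots m n \<and> (r, v) \<in> (adj F)\<^sup>*)"

definition level :: "nat \<Rightarrow> nat \<Rightarrow> vertex set set \<Rightarrow> vertex \<Rightarrow> nat" where
  "level m n F v = graph_dist F (root_of m n F v) v"

definition is_child :: "nat \<Rightarrow> nat \<Rightarrow> vertex set set \<Rightarrow> vertex \<Rightarrow> vertex \<Rightarrow> bool" where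
  "is_child m n F u v \<longleftrightarrow> {u, v} \<in> F \<and> level m n F v = Suc (level m n F u)"
  \<comment> \<open>\<open>v\<close> is a child of \<open>u\<close>\<close>

definition parent :: "nat \<Rightarrow> nat \<Rightarrow> vertex set set \<Rightarrow> vertex \<Rightarrow> vertex" where
  "parent m n F v = (THE u. is_child m n F u v)"

definition forest_degree :: "nat \<Rightarrow> nat \<Rightarrow> vertex set set \<Rightarrow> vertex \<Rightarrow> nat" where
  "forest_degree m n F u = card {v. is_child m n F u v}"


section \<open>Breadth first search\<close>

definition ordered_children :: "nat \<Rightarrow> nat \<Rightarrow> vertex set set \<Rightarrow> vertex \<Rightarrow> vertex list" where
  "ordered_children m n F u = map Node (sorted_list_of_set {i. is_child m n F u (Node i)})"

text \<open>The vertices at a given level, in BFS order: concatenating the increasingly labeled children of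
  the vertices of the previous level sorts by the position of the parent first and by the label
  second.\<close>

fun bfs_level :: "nat \<Rightarrow> nat \<Rightarrow> vertex set set \<Rightarrow> nat \<Rightarrow> vertex list" where
  "bfs_level m n F 0 = map Root [1..<n - m + 2]"
| "bfs_level m n F (Suc k) = concat (map (ordered_children m n F) (bfs_level m n F k))"

text \<open>With \<open>m\<close> non-root vertices no vertex has level greater than \<open>m\<close>.\<close>

definition bfs_order :: "nat \<Rightarrow> nat \<Rightarrow> vertex set set \<Rightarrow> vertex list" where
  "bfs_order m n F = concat (map (bfs_level m n F) [0..<Suc m])"

text \<open>Positions are counted from \<open>1\<close>.\<close>

definition bfs_position :: "nat \<Rightarrow> nat \<Rightarrow> vertex set set \<Rightarrow> vertex \<Rightarrow> nat" where
  "bfs_position m n F v = Suc (length (takeWhile (\<lambda>u. u \<noteq> v) (bfs_order m n F)))"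

definition bfs_map :: "nat \<Rightarrow> nat \<Rightarrow> vertex set set \<Rightarrow> nat \<Rightarrow> nat" where
  "bfs_map m n F = (\<lambda>i\<in>{1..m}. bfs_position m n F (parent m n F (Node i)))"


section \<open>Equidistribution\<close>

definition equidistributed :: "'a set \<Rightarrow> ('a \<Rightarrow> 'c) \<Rightarrow> 'b set \<Rightarrow> ('b \<Rightarrow> 'c) \<Rightarrow> bool" where
  "equidistributed A f B g \<longleftrightarrow> (\<forall>c. card {a \<in> A. f a = c} = card {b \<in> B. g b = c})"

end

theory Submission
  imports Defs
begin

text \<open>
  Let \<open>L\<close> be the breadth first search order of a forest \<open>F\<close>. Breadth first search is a queue: the
  roots enter first, and then each vertex that is read appends its children, so
  \<open>L = roots @ concat (map children L)\<close> (\<open>bfs_order_queue\<close>). If \<open>\<pi>\<close> is the image of \<open>F\<close>, the children of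
  the \<open>j\<close>-th vertex of \<open>L\<close> are, by definition of \<open>\<pi>\<close>, the \<open>k\<close> with \<open>\<pi> k = j\<close>. This gives the two
  statements about degrees. It also shows that \<open>L\<close>, which is the roots followed by the blocks
  \<open>{k. \<pi> k = j}\<close> for \<open>j = 1, 2, \<dots>\<close>, can be recovered from \<open>\<pi>\<close>; and \<open>L\<close> and \<open>\<pi>\<close> together give the parent
  of every non-root vertex, hence \<open>F\<close>. So the map is injective.

  The parking condition says that the queue never runs empty: the roots and the children of the
  first \<open>i\<close> vertices number \<open>n - m + 1 + #{k. \<pi> k \<le> i}\<close>, and the condition for \<open>i\<close> is that this
  exceeds \<open>i\<close>. For a forest it holds for all \<open>i \<le> n\<close>, since otherwise the vertices in the queue would
  be closed under taking children and contain all roots, without being all \<open>n + 1\<close> vertices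
  (\<open>bfs_order_progress\<close>).

  Conversely, let \<open>\<pi>\<close> be a parking function, let \<open>L\<close> be the roots followed by the blocks of \<open>\<pi>\<close>, and let
  the parent of \<open>i\<close> be entry number \<open>\<pi> i\<close> of \<open>L\<close>. By the parking condition this parent precedes \<open>i\<close> in
  \<open>L\<close>, and a parent map that lowers a rank defines a rooted forest (\<open>edges_rooted_forest\<close>). The
  list \<open>L\<close> and the breadth first search order of this forest satisfy the same queue equation, which
  has only one solution of given length if the queue never runs empty (\<open>queue_equation_unique\<close>).
  So the two lists agree, and the map sends the forest to \<open>\<pi>\<close>.
\<close>

section \<open>Lists that satisfy a queue equation\<close>

lemma distinct_concat_map:
  assumes "distinct xs" "\<And>x. x \<in> set xs \<Longrightarrow> distinct (f x)"
    and "\<And>x y. x \<in> set xs \<Longrightarrow> y \<in> set xs \<Longrightarrow> x \<noteq> y \<Longrightarrow> set (f x) \<inter> set (f y) = {}"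
  shows "distinct (concat (map f xs))"
  using assms
proof (induction xs)
  case (Cons a xs)
  then have "distinct (concat (map f xs))"
    by simp
  moreover have "set (f a) \<inter> set (concat (map f xs)) = {}"
    using Cons.prems by fastforce
  ultimately show ?case
    using Cons.prems by simp
qed simp

lemma queue_equation_split:
  assumes "xs = R @ concat (map f xs)"
  shows "xs = (R @ concat (map f (take i xs))) @ concat (map f (drop i xs))"
  by (metis assms append.assoc append_take_drop_id concat_append map_append)

text \<open>As long as the queue is not empty, reading \<open>k\<close> entries determines entry number \<open>k + 1\<close>, so the two
solutions agree on longer and longer prefixes. The progress of one solution carries over to the
other, because the condition at \<open>i\<close> depends only on the first \<open>i\<close> entries.\<close>

lemma queue_equation_unique:
  assumes xs: "xs = R @ concat (map f xs)" and ys: "ys = R @ concat (map f ys)"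
    and len: "length xs = length ys"
    and progress: "\<And>i. i < length xs \<Longrightarrow> i < length (R @ concat (map f (take i xs)))"
  shows "xs = ys"
proof -
  have "take k xs = take k ys" if "k \<le> length xs" for k
    using that
  proof (induction k)
    case (Suc k)
    let ?P = "R @ concat (map f (take k xs))"
    have same: "take k xs = take k ys" and long: "Suc k \<le> length ?P"
      using Suc progress[of k] by simp_all
    have "take (Suc k) xs = take (Suc k) ?P"
      by (subst queue_equation_split[OF xs, of k]) (use long in simp)
    moreover have "take (Suc k) ys = take (Suc k) ?P"
      by (subst queue_equation_split[OF ys, of k]) (use long same in simp)
    ultimately show ?case
      by simp
  qed simp
  from this[of "length xs"] show ?thesis
    using len by simp
qed

lemma length_takeWhile_neq_nth:
  assumes "distinct xs" "j < length xs"
  shows "length (takeWhile (\<lambda>u. u \<noteq> xs ! j) xs) = j"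
  using assms
proof (induction xs arbitrary: j)
  case (Cons a xs)
  then show ?case
    by (cases j) auto
qed simp

lemma nth_length_takeWhile_neq:
  assumes "v \<in> set xs"
  shows "length (takeWhile (\<lambda>u. u \<noteq> v) xs) < length xs"
    and "xs ! length (takeWhile (\<lambda>u. u \<noteq> v) xs) = v"
  using assms by (induction xs) auto

lemma length_le_takeWhile_neq:
  assumes "v \<notin> set ps"
  shows "length ps \<le> length (takeWhile (\<lambda>u. u \<noteq> v) (ps @ qs))"
  using assms by (induction ps) auto

section \<open>Vertices\<close>

lemma finite_vertices [simp]: "finite (vertices m n)"
  by (simp add: vertices_def roots_def)

lemma card_vertices:
  assumes "m \<le> n"
  shows "card (vertices m n) = Suc n"
proof -
  have "card (vertices m n) = card (roots m n) + card (Node ` {1..m})"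
    unfolding vertices_def by (rule card_Un_disjoint) (auto simp: roots_def)
  also have "\<dots> = (n - m + 1) + m"
    by (simp add: roots_def card_image inj_on_def)
  finally show ?thesis
    using assms by simp
qed

lemma set_bfs_level_0: "set (bfs_level m n F 0) = roots m n"
  by (auto simp: roots_def)

lemma Node_in_vertices [simp]: "Node i \<in> vertices m n \<longleftrightarrow> i \<in> {1..m}"
  by (auto simp: vertices_def roots_def)

lemma Node_notin_roots [simp]: "Node i \<notin> roots m n"
  by (auto simp: roots_def)

lemma roots_subset_vertices: "roots m n \<subseteq> vertices m n"
  by (simp add: vertices_def)

lemma vertex_cases:
  assumes "v \<in> vertices m n"
  obtains "v \<in> roots m n" | i where "i \<in> {1..m}" "v = Node i"
  using assms by (auto simp: vertices_def)

section \<open>Parents and levels in a rooted forest\<close>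

locale rooted_forest =
  fixes m n :: nat and F :: "vertex set set"
  assumes m_le_n: "m \<le> n" and forest: "F \<in> rooted_forests m n"
begin

lemma edgeD:
  assumes "{u, v} \<in> F"
  shows "u \<in> vertices m n" "v \<in> vertices m n"
proof -
  have "{u, v} \<in> {{u, v} | u v. u \<in> vertices m n \<and> v \<in> vertices m n \<and> u \<noteq> v}"
    using forest assms by (auto simp: rooted_forests_def)
  then show "u \<in> vertices m n" "v \<in> vertices m n"
    by (auto simp: doubleton_eq_iff)
qed

lemma card_edges: "card F = m"
  using forest by (simp add: rooted_forests_def)

lemma finite_edges: "finite F"
proof (rule finite_subset)
  show "F \<subseteq> Pow (vertices m n)"
    using forest by (auto simp: rooted_forests_def)
qed simp

lemma ex1_root:
  assumes "v \<in> vertices m n"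
  shows "\<exists>!r. r \<in> roots m n \<and> (r, v) \<in> (adj F)\<^sup>*"
  using forest assms by (simp add: rooted_forests_def)

lemma root_of:
  assumes "v \<in> vertices m n"
  shows "root_of m n F v \<in> roots m n" "(root_of m n F v, v) \<in> (adj F)\<^sup>*"
  using theI'[OF ex1_root[OF assms]] by (simp_all add: root_of_def)

lemma root_of_eq:
  assumes "v \<in> vertices m n" "r \<in> roots m n" "(r, v) \<in> (adj F)\<^sup>*"
  shows "root_of m n F v = r"
  using ex1_root[OF assms(1)] root_of[OF assms(1)] assms(2,3) by blast

lemma root_of_edge:
  assumes "{u, v} \<in> F"
  shows "root_of m n F v = root_of m n F u"
proof (rule root_of_eq)
  have "(u, v) \<in> adj F"
    using assms by (simp add: adj_def)
  then show "(root_of m n F u, v) \<in> (adj F)\<^sup>*"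
    using root_of(2)[OF edgeD(1)[OF assms]] by (meson rtrancl.rtrancl_into_rtrancl)
qed (use edgeD[OF assms] root_of in auto)

lemma level_walk:
  assumes "v \<in> vertices m n"
  shows "(root_of m n F v, v) \<in> adj F ^^ level m n F v"
  unfolding level_def graph_dist_def
  using rtrancl_imp_relpow[OF root_of(2)[OF assms]] by (metis (mono_tags, lifting) LeastI)

lemma level_le_walk:
  assumes "(root_of m n F v, v) \<in> adj F ^^ k"
  shows "level m n F v \<le> k"
  unfolding level_def graph_dist_def using assms by (rule Least_le)

lemma level_edge:
  assumes "{u, v} \<in> F"
  shows "level m n F v \<le> Suc (level m n F u)"
proof (rule level_le_walk)
  have "(u, v) \<in> adj F"
    using assms by (simp add: adj_def)
  then show "(root_of m n F v, v) \<in> adj F ^^ Suc (level m n F u)"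
    using level_walk[OF edgeD(1)[OF assms]] root_of_edge[OF assms] by auto
qed

lemma level_eq_0_iff:
  assumes "v \<in> vertices m n"
  shows "level m n F v = 0 \<longleftrightarrow> v \<in> roots m n"
proof
  assume "level m n F v = 0"
  then show "v \<in> roots m n"
    using level_walk[OF assms] root_of(1)[OF assms] by simp
next
  assume "v \<in> roots m n"
  then have "root_of m n F v = v"
    using assms by (intro root_of_eq) auto
  then show "level m n F v = 0"
    using level_le_walk[of v 0] by simp
qed

lemma is_childD:
  assumes "is_child m n F u v"
  shows "u \<in> vertices m n" "v \<in> vertices m n" "v \<notin> roots m n"
proof -
  show "u \<in> vertices m n" and v: "v \<in> vertices m n"
    using assms edgeD by (auto simp: is_child_def)
  show "v \<notin> roots m n"
    using assms level_eq_0_iff[OF v] by (simp add: is_child_def)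
qed

lemma ex_is_child:
  assumes v: "v \<in> vertices m n" and "v \<notin> roots m n"
  shows "\<exists>u. is_child m n F u v"
proof -
  obtain k where k: "level m n F v = Suc k"
    using assms level_eq_0_iff[OF v] by (cases "level m n F v") auto
  then obtain u where u: "(root_of m n F v, u) \<in> adj F ^^ k" "{u, v} \<in> F"
    using level_walk[OF v] by (auto simp: adj_def)
  then have "level m n F u \<le> k"
    using level_le_walk[of u k] root_of_edge[OF u(2)] by simp
  then have "level m n F v = Suc (level m n F u)"
    using level_edge[OF u(2)] k by simp
  then show ?thesis
    using u by (auto simp: is_child_def)
qed

lemma is_child_same_edge:
  assumes "is_child m n F u v" "is_child m n F u' v'" "{u, v} = {u', v'}"
  shows "u = u' \<and> v = v'"
  using assms by (auto simp: is_child_def doubleton_eq_iff)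

text \<open>That a non-root vertex has only one parent is a matter of counting: one parent chosen for each of
the \<open>m\<close> non-root vertices gives \<open>m\<close> different edges, since an edge to a child determines the child by
its level. These are all the edges, so there is no room for a second parent.\<close>

lemma
  shows is_child_Node_iff:
      "i \<in> {1..m} \<Longrightarrow> is_child m n F u (Node i) \<longleftrightarrow> u = parent m n F (Node i)"
    and edges_eq: "F = (\<lambda>i. {parent m n F (Node i), Node i}) ` {1..m}"
proof -
  have "\<forall>i\<in>{1..m}. \<exists>u. is_child m n F u (Node i)"
    using ex_is_child by simp
  then obtain p where p: "\<And>i. i \<in> {1..m} \<Longrightarrow> is_child m n F (p i) (Node i)"
    by metis
  have "inj_on (\<lambda>i. {p i, Node i}) {1..m}"
    using p is_child_same_edge by (intro inj_onI) blast
  then have "card ((\<lambda>i. {p i, Node i}) ` {1..m}) = card F"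
    by (simp add: card_image card_edges)
  moreover have "(\<lambda>i. {p i, Node i}) ` {1..m} \<subseteq> F"
    using p by (auto simp: is_child_def)
  ultimately have F: "F = (\<lambda>i. {p i, Node i}) ` {1..m}"
    using finite_edges card_subset_eq by metis
  have uniq: "u = p i" if i: "i \<in> {1..m}" and u: "is_child m n F u (Node i)" for u i
  proof -
    have "{u, Node i} \<in> (\<lambda>i. {p i, Node i}) ` {1..m}"
      using u F by (simp add: is_child_def)
    then obtain k where k: "k \<in> {1..m}" "{u, Node i} = {p k, Node k}"
      by auto
    then have "u = p k \<and> Node i = Node k"
      using is_child_same_edge[OF u p[OF k(1)]] by blast
    then show ?thesis
      by simp
  qed
  have par: "parent m n F (Node i) = p i" if "i \<in> {1..m}" for i
    unfolding parent_def using p[OF that] uniq[OF that] by (rule the_equality)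
  show "is_child m n F u (Node i) \<longleftrightarrow> u = parent m n F (Node i)" if "i \<in> {1..m}"
    using par[OF that] p[OF that] uniq[OF that] by metis
  have "(\<lambda>i. {p i, Node i}) ` {1..m} = (\<lambda>i. {parent m n F (Node i), Node i}) ` {1..m}"
    using par by (intro image_cong) simp_all
  with F show "F = (\<lambda>i. {parent m n F (Node i), Node i}) ` {1..m}"
    by (rule trans)
qed

lemma is_child_iff:
  "is_child m n F u v \<longleftrightarrow> (\<exists>i\<in>{1..m}. v = Node i \<and> u = parent m n F (Node i))"
proof
  assume child: "is_child m n F u v"
  then obtain i where "i \<in> {1..m}" "v = Node i"
    using is_childD[OF child] by (auto elim: vertex_cases)
  then show "\<exists>i\<in>{1..m}. v = Node i \<and> u = parent m n F (Node i)"
    using child is_child_Node_iff by auto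
qed (auto simp: is_child_Node_iff)

lemma children_labels:
  "{i. is_child m n F u (Node i)} = {i \<in> {1..m}. parent m n F (Node i) = u}"
  by (auto simp: is_child_iff)

lemma parent_in_vertices:
  assumes "i \<in> {1..m}"
  shows "parent m n F (Node i) \<in> vertices m n"
  using is_childD(1) is_child_Node_iff[OF assms] by blast

lemma forest_degree_eq: "forest_degree m n F u = card {i \<in> {1..m}. parent m n F (Node i) = u}"
proof -
  have "{v. is_child m n F u v} = Node ` {i \<in> {1..m}. parent m n F (Node i) = u}"
    by (auto simp: is_child_iff)
  then show ?thesis
    by (simp add: forest_degree_def card_image inj_on_def)
qed

text \<open>The vertices on the path from the root realise all smaller levels. In \<open>level_le\<close> this yields as many
different non-root vertices as the level, which is why listing the levels up to \<open>m\<close> is enough.\<close>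

lemma level_attained:
  assumes "v \<in> vertices m n" "k \<le> level m n F v"
  shows "\<exists>u\<in>vertices m n. level m n F u = k"
  using assms
proof (induction "level m n F v" arbitrary: v)
  case (Suc l)
  then obtain u where u: "is_child m n F u v"
    using ex_is_child level_eq_0_iff by (metis nat.distinct(1))
  show ?case
  proof (cases "k = level m n F v")
    case False
    with u Suc show ?thesis
      using is_childD(1)[OF u] by (auto simp: is_child_def)
  qed (use Suc.prems in blast)
qed auto

lemma level_le:
  assumes "v \<in> vertices m n"
  shows "level m n F v \<le> m"
proof -
  have "{1..level m n F v} \<subseteq> (\<lambda>i. level m n F (Node i)) ` {1..m}"
  proof
    fix k assume k: "k \<in> {1..level m n F v}"
    then obtain u where u: "u \<in> vertices m n" "level m n F u = k"
      using level_attained[OF assms, of k] by auto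
    then have "u \<notin> roots m n"
      using level_eq_0_iff[OF u(1)] k by auto
    then obtain i where "i \<in> {1..m}" "u = Node i"
      using u(1) by (auto elim: vertex_cases)
    then show "k \<in> (\<lambda>i. level m n F (Node i)) ` {1..m}"
      using u by auto
  qed
  then have "card {1..level m n F v} \<le> card {1..m}"
    by (rule surj_card_le[rotated]) simp
  then show ?thesis
    by simp
qed

section \<open>The breadth first search order\<close>

lemma finite_children_labels: "finite {i. is_child m n F u (Node i)}"
  by (simp add: children_labels)

lemma set_ordered_children: "set (ordered_children m n F u) = {v. is_child m n F u v}"
  using finite_children_labels by (auto simp: ordered_children_def is_child_iff)

lemma distinct_ordered_children: "distinct (ordered_children m n F u)"
  by (simp add: ordered_children_def distinct_map inj_on_def)

lemma ordered_children_disjoint: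
  assumes "u \<noteq> u'"
  shows "set (ordered_children m n F u) \<inter> set (ordered_children m n F u') = {}"
  using assms by (auto simp: set_ordered_children is_child_iff)

lemma set_bfs_level: "set (bfs_level m n F k) = {v \<in> vertices m n. level m n F v = k}"
proof (induction k)
  case 0
  then show ?case
    using level_eq_0_iff roots_subset_vertices unfolding set_bfs_level_0 by blast
next
  case (Suc k)
  have "\<exists>u\<in>vertices m n. level m n F u = k \<and> is_child m n F u v"
    if "v \<in> vertices m n" "level m n F v = Suc k" for v
    using ex_is_child[of v] level_eq_0_iff[of v] that is_childD(1)
    by (fastforce simp: is_child_def)
  then show ?case
    using Suc by (auto simp: set_ordered_children is_childD) (auto simp: is_child_def)
qed

lemma distinct_bfs_level: "distinct (bfs_level m n F k)"
proof (induction k)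
  case (Suc k)
  then show ?case
    using distinct_ordered_children ordered_children_disjoint by (auto intro!: distinct_concat_map)
qed (simp add: distinct_map inj_on_def del: upt_Suc)

lemma set_bfs_order: "set (bfs_order m n F) = vertices m n"
  using level_le by (fastforce simp: bfs_order_def set_bfs_level simp del: bfs_level.simps upt_Suc)

lemma distinct_bfs_order: "distinct (bfs_order m n F)"
  unfolding bfs_order_def
  by (rule distinct_concat_map) (auto simp: distinct_bfs_level set_bfs_level simp del: upt_Suc)

lemma length_bfs_order: "length (bfs_order m n F) = Suc n"
  using distinct_card[OF distinct_bfs_order] card_vertices[OF m_le_n] by (simp add: set_bfs_order)

text \<open>Taking children shifts the levels by one, so prefixing the roots restores the list of all levels,
with the empty level \<open>m + 1\<close> at its end.\<close>

lemma bfs_order_queue: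
  "bfs_order m n F =
     map Root [1..<n - m + 2] @ concat (map (ordered_children m n F) (bfs_order m n F))"
proof -
  let ?level = "bfs_level m n F" and ?ch = "ordered_children m n F"
  have step: "?level 0 @ concat (map ?ch (concat (map ?level [0..<k])))
      = concat (map ?level [0..<Suc k])" for k
    by (induction k) (simp_all del: upt_Suc add: upt_Suc_append)
  have "?level (Suc m) = []"
    using level_le set_bfs_level[of "Suc m"]
    by (metis (mono_tags, lifting) Suc_n_not_le_n empty_Collect_eq set_empty)
  then have "concat (map ?level [0..<Suc (Suc m)]) = bfs_order m n F"
    by (simp add: bfs_order_def upt_Suc_append[of 0 "Suc m"] del: upt_Suc bfs_level.simps)
  then show ?thesis
    using step[of "Suc m"] by (simp add: bfs_order_def del: upt_Suc)
qed

text \<open>If the roots and the children of the first \<open>i\<close> vertices filled at most \<open>i\<close> places, all of them would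
be among the first \<open>i\<close> vertices. They would then be closed under taking children, and by induction
on the level every vertex would be one of them, although there are \<open>n + 1 > i\<close> vertices.\<close>

lemma bfs_order_progress:
  assumes "i \<le> n"
  shows "i < length (map Root [1..<n - m + 2] @
    concat (map (ordered_children m n F) (take i (bfs_order m n F))))" (is "i < length ?P")
proof (rule ccontr)
  assume "\<not> i < length ?P"
  then have short: "length ?P \<le> i"
    by simp
  have "?P = take (length ?P) (bfs_order m n F)"
    by (subst (3) queue_equation_split[OF bfs_order_queue, of i]) simp
  then have seen: "set ?P \<subseteq> set (take i (bfs_order m n F))"
    using set_take_subset_set_take[OF short, of "bfs_order m n F"] by (metis (no_types))
  have "v \<in> set ?P" if "v \<in> vertices m n" for v
    using that
  proof (induction "level m n F v" arbitrary: v)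
    case 0
    then have "v \<in> set (bfs_level m n F 0)"
      by (simp only: set_bfs_level mem_Collect_eq)
    then show ?case
      by (simp del: upt_Suc)
  next
    case (Suc k)
    then obtain u where u: "is_child m n F u v"
      using ex_is_child level_eq_0_iff by (metis nat.distinct(1))
    then have "u \<in> set ?P"
      using Suc is_childD(1)[OF u] by (auto simp: is_child_def)
    then have "u \<in> set (take i (bfs_order m n F))"
      using seen by blast
    then show ?case
      using u by (auto simp: set_ordered_children)
  qed
  then have "card (vertices m n) \<le> card (set ?P)"
    by (intro card_mono) blast+
  also have "\<dots> \<le> length ?P"
    by (rule card_length)
  finally show False
    using short assms card_vertices[OF m_le_n] by simp
qed

lemma bfs_position:
  assumes "v \<in> vertices m n"
  shows "bfs_position m n F v \<in> {1..Suc n}" "bfs_order m n F ! (bfs_position m n F v - 1) = v"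
  using nth_length_takeWhile_neq[of v "bfs_order m n F"] assms
  by (auto simp: bfs_position_def set_bfs_order length_bfs_order)

lemma bfs_position_nth:
  assumes "j \<le> n"
  shows "bfs_position m n F (bfs_order m n F ! j) = Suc j"
  using length_takeWhile_neq_nth[OF distinct_bfs_order] assms
  by (simp add: bfs_position_def length_bfs_order)

lemma bfs_position_eq_iff:
  assumes "u \<in> vertices m n" "v \<in> vertices m n"
  shows "bfs_position m n F u = bfs_position m n F v \<longleftrightarrow> u = v"
  using bfs_position(2) assms by metis

lemma bfs_position_Root:
  assumes "j \<in> {1..n - m + 1}"
  shows "bfs_position m n F (Root j) = j"
proof -
  have "j - 1 < n - m + 1"
    using assms by auto
  then have "bfs_order m n F ! (j - 1) = Root j"
    by (subst bfs_order_queue) (use assms in \<open>simp add: nth_append del: upt_Suc\<close>)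
  then show ?thesis
    using bfs_position_nth[of "j - 1"] assms by auto
qed

lemma bfs_map_apply:
  "i \<in> {1..m} \<Longrightarrow> bfs_map m n F i = bfs_position m n F (parent m n F (Node i))"
  by (simp add: bfs_map_def)

lemma occurrences_bfs_position:
  assumes "u \<in> vertices m n"
  shows "occurrences m (bfs_map m n F) (bfs_position m n F u) = forest_degree m n F u"
proof -
  have "{k \<in> {1..m}. bfs_map m n F k = bfs_position m n F u}
      = {k \<in> {1..m}. parent m n F (Node k) = u}"
    using bfs_position_eq_iff[OF parent_in_vertices assms] by (auto simp: bfs_map_apply)
  then show ?thesis
    by (simp add: occurrences_def forest_degree_eq)
qed

end

section \<open>Reconstructing the order from a sequence\<close>

text \<open>The children of the \<open>j\<close>-th vertex, as they are read off from the sequence alone.\<close>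

definition block :: "nat \<Rightarrow> (nat \<Rightarrow> nat) \<Rightarrow> nat \<Rightarrow> vertex list" where
  "block m \<pi> j = map Node (sorted_list_of_set {k \<in> {1..m}. \<pi> k = j})"

text \<open>
  The last block, for \<open>j = n + 1\<close>, is empty for a parking function. It is included because then the
  list has one block for each of its \<open>n + 1\<close> entries, as in the queue equation.
\<close>

definition queue_order :: "nat \<Rightarrow> nat \<Rightarrow> (nat \<Rightarrow> nat) \<Rightarrow> vertex list" where
  "queue_order m n \<pi> = map Root [1..<n - m + 2] @ concat (map (block m \<pi>) [1..<n + 2])"

lemma set_block: "set (block m \<pi> j) = Node ` {k \<in> {1..m}. \<pi> k = j}"
  by (simp add: block_def)

lemma length_block: "length (block m \<pi> j) = card {k \<in> {1..m}. \<pi> k = j}"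
  by (simp add: block_def)

lemma length_blocks:
  assumes "\<And>k. k \<in> {1..m} \<Longrightarrow> 1 \<le> \<pi> k"
  shows "length (concat (map (block m \<pi>) [1..<Suc i])) = card {k \<in> {1..m}. \<pi> k \<le> i}"
proof (induction i)
  case 0
  have none: "{k \<in> {1..m}. \<pi> k \<le> 0} = {}"
    using assms by fastforce
  show ?case
    unfolding none by simp
next
  case (Suc i)
  have "{k \<in> {1..m}. \<pi> k \<le> Suc i} = {k \<in> {1..m}. \<pi> k \<le> i} \<union> {k \<in> {1..m}. \<pi> k = Suc i}"
    by auto
  then have "card {k \<in> {1..m}. \<pi> k \<le> Suc i}
      = card {k \<in> {1..m}. \<pi> k \<le> i} + card {k \<in> {1..m}. \<pi> k = Suc i}"
    by (simp add: card_Un_disjoint disjoint_iff)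
  also have "\<dots> = length (concat (map (block m \<pi>) [1..<Suc i])) + length (block m \<pi> (Suc i))"
    by (simp only: Suc length_block)
  also have "\<dots> = length (concat (map (block m \<pi>) [1..<Suc (Suc i)]))"
    by (simp add: upt_Suc_append[of "Suc 0" "Suc i"] del: upt_Suc)
  finally show ?case ..
qed

lemma map_take_positions:
  assumes "\<And>j. j < length xs \<Longrightarrow> f (xs ! j) = g (Suc j)" "i \<le> length xs"
  shows "map f (take i xs) = map g [1..<Suc i]"
  using assms by (intro nth_equalityI) (auto simp del: upt_Suc)

context rooted_forest
begin

lemma ordered_children_nth:
  assumes "j \<le> n"
  shows "ordered_children m n F (bfs_order m n F ! j) = block m (bfs_map m n F) (Suc j)"
proof -
  have v: "bfs_order m n F ! j \<in> vertices m n"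
    using assms nth_mem[of j "bfs_order m n F"] by (simp add: length_bfs_order set_bfs_order)
  have "parent m n F (Node k) = bfs_order m n F ! j \<longleftrightarrow> bfs_map m n F k = Suc j"
    if "k \<in> {1..m}" for k
    using bfs_position_eq_iff[OF parent_in_vertices[OF that] v] bfs_position_nth[OF assms]
    by (simp add: bfs_map_apply[OF that])
  then show ?thesis
    unfolding ordered_children_def block_def children_labels
    by (intro arg_cong[where f = "\<lambda>A. map Node (sorted_list_of_set A)"]) auto
qed

lemma map_ordered_children_take:
  assumes "i \<le> Suc n"
  shows "map (ordered_children m n F) (take i (bfs_order m n F))
       = map (block m (bfs_map m n F)) [1..<Suc i]"
  using assms by (intro map_take_positions) (auto simp: length_bfs_order ordered_children_nth)

lemma bfs_order_eq: "bfs_order m n F = queue_order m n (bfs_map m n F)"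
  using map_ordered_children_take[of "Suc n"] bfs_order_queue
  by (simp add: queue_order_def length_bfs_order del: upt_Suc)

lemma bfs_map_parking: "bfs_map m n F \<in> parking_functions m n"
proof -
  let ?\<pi> = "bfs_map m n F"
  have range: "?\<pi> k \<in> {1..Suc n}" if "k \<in> {1..m}" for k
    using bfs_position(1)[OF parent_in_vertices[OF that]] by (simp add: bfs_map_apply[OF that])
  have count: "card {k \<in> {1..m}. ?\<pi> k \<le> i} \<ge> m + i - n" if "i \<in> {n - m + 1..n}" for i
  proof -
    have "i < (n - m + 1) + length (concat (map (block m ?\<pi>) [1..<Suc i]))"
      using bfs_order_progress[of i] map_ordered_children_take[of i] that
      by (simp del: upt_Suc)
    also have "length (concat (map (block m ?\<pi>) [1..<Suc i])) = card {k \<in> {1..m}. ?\<pi> k \<le> i}"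
      using range by (intro length_blocks) auto
    finally show ?thesis
      using m_le_n that by auto
  qed
  \<comment> \<open>Position \<open>n + 1\<close> has no children: the condition for \<open>i = n\<close> already accounts for all \<open>m\<close> entries.\<close>
  have "?\<pi> k \<le> n" if "k \<in> {1..m}" for k
  proof -
    have "n \<in> {n - m + 1..n}"
      using that m_le_n by auto
    then have "card {1..m} \<le> card {k \<in> {1..m}. ?\<pi> k \<le> n}"
      using count[of n] by simp
    then have "{k \<in> {1..m}. ?\<pi> k \<le> n} = {1..m}"
      by (intro card_seteq) auto
    then show ?thesis
      using that by blast
  qed
  moreover have "?\<pi> \<in> extensional {1..m}"
    by (simp add: bfs_map_def)
  ultimately show ?thesis
    using range count by (auto simp: parking_functions_def PiE_def)
qed

end

lemma inj_on_bfs_map: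
  assumes "m \<le> n"
  shows "inj_on (bfs_map m n) (rooted_forests m n)"
proof (rule inj_onI)
  fix F G assume F: "F \<in> rooted_forests m n" and G: "G \<in> rooted_forests m n"
    and eq: "bfs_map m n F = bfs_map m n G"
  interpret F: rooted_forest m n F
    using assms F by unfold_locales
  interpret G: rooted_forest m n G
    using assms G by unfold_locales
  have order: "bfs_order m n F = bfs_order m n G"
    by (simp add: F.bfs_order_eq G.bfs_order_eq eq)
  have "parent m n F (Node i) = parent m n G (Node i)" if "i \<in> {1..m}" for i
    using F.bfs_position(2)[OF F.parent_in_vertices[OF that]]
      G.bfs_position(2)[OF G.parent_in_vertices[OF that]]
    by (metis F.bfs_map_apply G.bfs_map_apply eq order that)
  then have "(\<lambda>i. {parent m n F (Node i), Node i}) ` {1..m}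
      = (\<lambda>i. {parent m n G (Node i), Node i}) ` {1..m}"
    by (intro image_cong) auto
  then show "F = G"
    using F.edges_eq G.edges_eq by simp
qed

section \<open>The forest of a parent map\<close>

text \<open>The rank makes every chain of parents end at a root. It is left abstract so that the position in a
list can serve as the rank.\<close>

locale parent_map =
  fixes m n :: nat and p :: "nat \<Rightarrow> vertex" and rank :: "vertex \<Rightarrow> nat"
  assumes parent_vertex: "i \<in> {1..m} \<Longrightarrow> p i \<in> vertices m n"
    and rank_parent: "i \<in> {1..m} \<Longrightarrow> rank (p i) < rank (Node i)"
begin

definition edges :: "vertex set set" where
  "edges = (\<lambda>i. {p i, Node i}) ` {1..m}"

definition up :: "vertex \<Rightarrow> vertex" where
  "up v = (case v of Root j \<Rightarrow> Root j | Node i \<Rightarrow> p i)"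

text \<open>
  The depth turns out to be the level, and the apex the root of the tree of a vertex. Both are defined
  by following parents, which avoids any reference to walks in the graph.
\<close>

definition depth :: "vertex \<Rightarrow> nat" where
  "depth v = (LEAST k. (up ^^ k) v \<in> roots m n)"

definition apex :: "vertex \<Rightarrow> vertex" where
  "apex v = (up ^^ depth v) v"

lemma up_Node [simp]: "up (Node i) = p i"
  by (simp add: up_def)

lemma reaches_root:
  assumes "v \<in> vertices m n"
  shows "\<exists>k. (up ^^ k) v \<in> roots m n"
  using assms
proof (induction v rule: measure_induct_rule[of rank])
  case (less v)
  from less.prems show ?case
  proof (cases rule: vertex_cases)
    case 1
    then show ?thesis
      by (intro exI[of _ 0]) simp
  next
    case (2 i)
    then obtain k where "(up ^^ k) (p i) \<in> roots m n"
      using less.IH[of "p i"] rank_parent parent_vertex by auto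
    then show ?thesis
      using 2 by (intro exI[of _ "Suc k"]) (simp add: funpow_swap1)
  qed
qed

lemma depth_root: "r \<in> roots m n \<Longrightarrow> depth r = 0"
  by (simp add: depth_def)

lemma apex_root: "r \<in> roots m n \<Longrightarrow> apex r = r"
  by (simp add: apex_def depth_root)

lemma depth_Node:
  assumes "i \<in> {1..m}"
  shows "depth (Node i) = Suc (depth (p i))"
proof -
  obtain k where "(up ^^ k) (Node i) \<in> roots m n"
    using reaches_root[of "Node i"] assms by auto
  then have "(LEAST k. (up ^^ k) (Node i) \<in> roots m n)
      = Suc (LEAST k. (up ^^ Suc k) (Node i) \<in> roots m n)"
    by (rule Least_Suc) simp
  then show ?thesis
    by (simp add: depth_def funpow_swap1)
qed

lemma apex_Node:
  assumes "i \<in> {1..m}"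
  shows "apex (Node i) = apex (p i)"
  by (simp add: apex_def depth_Node[OF assms] funpow_swap1)

lemma apex_in_roots:
  assumes "v \<in> vertices m n"
  shows "apex v \<in> roots m n"
  using reaches_root[OF assms] unfolding apex_def depth_def by (rule LeastI_ex)

lemma edge_iff:
  "{u, v} \<in> edges \<longleftrightarrow> (\<exists>i\<in>{1..m}. u = p i \<and> v = Node i \<or> v = p i \<and> u = Node i)"
  by (auto simp: edges_def doubleton_eq_iff)

lemma apex_edge: "{u, v} \<in> edges \<Longrightarrow> apex u = apex v"
  by (auto simp: edge_iff apex_Node)

lemma apex_reachable:
  assumes "(u, v) \<in> (adj edges)\<^sup>*"
  shows "apex u = apex v"
  using assms by (induction rule: rtrancl_induct) (auto simp: adj_def dest: apex_edge)

lemma depth_walk_le: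
  assumes "r \<in> roots m n" "(r, v) \<in> adj edges ^^ k"
  shows "depth v \<le> k"
  using assms(2)
proof (induction k arbitrary: v)
  case (Suc k)
  then obtain u where "(r, u) \<in> adj edges ^^ k" "{u, v} \<in> edges"
    by (auto simp: adj_def)
  moreover from this(2) have "depth v \<le> Suc (depth u)"
    by (auto simp: edge_iff depth_Node)
  ultimately show ?case
    using Suc.IH by fastforce
qed (use assms depth_root in auto)

lemma apex_walk:
  assumes "v \<in> vertices m n"
  shows "(apex v, v) \<in> adj edges ^^ depth v"
  using assms
proof (induction v rule: measure_induct_rule[of rank])
  case (less v)
  from less.prems show ?case
  proof (cases rule: vertex_cases)
    case 1
    then show ?thesis
      by (simp add: apex_root depth_root)
  next
    case (2 i)
    then have "(apex (p i), p i) \<in> adj edges ^^ depth (p i)"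
      using less.IH[of "p i"] rank_parent parent_vertex by auto
    moreover have "(p i, Node i) \<in> adj edges"
      using 2 by (auto simp: adj_def edge_iff)
    ultimately show ?thesis
      using 2 by (auto simp: apex_Node depth_Node)
  qed
qed

text \<open>Since the apex is constant along edges, it is the only root that a vertex is connected to.\<close>

lemma ex1_root_edges:
  assumes "v \<in> vertices m n"
  shows "\<exists>!r. r \<in> roots m n \<and> (r, v) \<in> (adj edges)\<^sup>*"
proof (rule ex1I[of _ "apex v"])
  show "apex v \<in> roots m n \<and> (apex v, v) \<in> (adj edges)\<^sup>*"
    using apex_in_roots apex_walk relpow_imp_rtrancl assms by blast
  show "r = apex v" if "r \<in> roots m n \<and> (r, v) \<in> (adj edges)\<^sup>*" for r
    using that apex_reachable apex_root by metis
qed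

text \<open>A vertex of maximal rank on a cycle has two different neighbours on it. Along an edge the parent
has the smaller rank, so both would be parents of that vertex.\<close>

lemma edges_acyclic: "\<not> is_cycle edges c"
proof
  assume "is_cycle edges c"
  then have len: "length c \<ge> 3" and dist: "distinct c"
    and succ: "successively (\<lambda>u v. {u, v} \<in> edges) c" and closing: "{last c, hd c} \<in> edges"
    by (auto simp: is_cycle_def)
  have step: "{c ! a, c ! Suc a} \<in> edges" if "Suc a < length c" for a
    using succ that by (simp add: successively_conv_nth)
  have wrap: "{c ! (length c - 1), c ! 0} \<in> edges"
    using closing len by (metis hd_conv_nth last_conv_nth list.size(3) not_numeral_le_zero)
  have "Max (rank ` set c) \<in> rank ` set c"
    using len by (intro Max_in) auto
  then obtain a where a: "a < length c" "rank (c ! a) = Max (rank ` set c)"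
    by (auto simp: in_set_conv_nth)
  have top: "rank (c ! b) \<le> rank (c ! a)" if "b < length c" for b
    unfolding a(2) using that by (intro Max_ge) auto
  have is_parent: "c ! b = up (c ! a)" if "b < length c" "{c ! a, c ! b} \<in> edges" for b
    using top[OF that(1)] that(2) rank_parent by (fastforce simp: edge_iff)
  \<comment> \<open>The two neighbours of position \<open>a\<close> on the cycle; they differ because the length is at least 3.\<close>
  define s t where "s = (if Suc a = length c then 0 else Suc a)"
    and "t = (if a = 0 then length c - 1 else a - 1)"
  have st: "s < length c" "t < length c" "s \<noteq> t"
    using len a(1) by (auto simp: s_def t_def)
  have "{c ! a, c ! s} \<in> edges"
    using step[of a] wrap a(1) by (metis Suc_lessI diff_Suc_1 s_def)
  moreover have "{c ! a, c ! t} \<in> edges"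
    using step[of "a - 1"] wrap a(1) by (auto simp: t_def insert_commute)
  ultimately have "c ! s = c ! t"
    using is_parent[OF st(1)] is_parent[OF st(2)] by metis
  then show False
    using dist st by (simp add: nth_eq_iff_index_eq)
qed

lemma edges_rooted_forest: "edges \<in> rooted_forests m n"
proof -
  have "p i \<noteq> Node i" if "i \<in> {1..m}" for i
    using rank_parent[OF that] by auto
  then have "edges \<subseteq> {{u, v} | u v. u \<in> vertices m n \<and> v \<in> vertices m n \<and> u \<noteq> v}"
    using parent_vertex by (fastforce simp: edges_def)
  moreover have "inj_on (\<lambda>i. {p i, Node i}) {1..m}"
  proof (rule inj_onI)
    fix i k assume "i \<in> {1..m}" "k \<in> {1..m}" "{p i, Node i} = {p k, Node k}"
    then show "i = k"
      using rank_parent[of i] rank_parent[of k] by (auto simp: doubleton_eq_iff)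
  qed
  then have "card edges = m"
    by (simp add: edges_def card_image)
  ultimately show ?thesis
    using edges_acyclic ex1_root_edges by (simp add: rooted_forests_def)
qed

text \<open>Depths change by at most one along an edge, so no walk from the root is shorter than the walk along
the parents.\<close>

lemma level_edges:
  assumes "v \<in> vertices m n"
  shows "level m n edges v = depth v"
proof -
  have "root_of m n edges v = apex v"
    unfolding root_of_def
    using ex1_root_edges[OF assms] apex_in_roots[OF assms]
      relpow_imp_rtrancl[OF apex_walk[OF assms]] by (intro the1_equality) auto
  then show ?thesis
    unfolding level_def graph_dist_def
    using apex_walk[OF assms] depth_walk_le[OF apex_in_roots[OF assms]]
    by (auto intro!: Least_equality)
qed

lemma is_child_edges_iff:
  "is_child m n edges u v \<longleftrightarrow> (\<exists>i\<in>{1..m}. v = Node i \<and> u = p i)"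
  unfolding is_child_def edge_iff
  using level_edges parent_vertex depth_Node by (auto 0 4)

lemma parent_edges:
  assumes "i \<in> {1..m}"
  shows "parent m n edges (Node i) = p i"
  using assms by (simp add: parent_def is_child_edges_iff)

end

section \<open>Every parking function comes from a forest\<close>

locale parking_function =
  fixes m n :: nat and \<pi> :: "nat \<Rightarrow> nat"
  assumes m_le_n: "m \<le> n" and parking: "\<pi> \<in> parking_functions m n"
begin

abbreviation "L \<equiv> queue_order m n \<pi>"

lemma range: "k \<in> {1..m} \<Longrightarrow> \<pi> k \<in> {1..n}"
  using parking by (auto simp: parking_functions_def)

lemma set_queue_order: "set L = vertices m n"
proof -
  have "set (concat (map (block m \<pi>) [1..<n + 2])) = Node ` {1..m}"
    using range by (fastforce simp: set_block simp del: upt_Suc)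
  moreover have "set (map Root [1..<n - m + 2]) = roots m n"
    by (auto simp: roots_def)
  ultimately show ?thesis
    unfolding queue_order_def vertices_def by (simp only: set_append)
qed

lemma length_prefix:
  "length (map Root [1..<n - m + 2] @ concat (map (block m \<pi>) [1..<Suc i]))
     = n - m + 1 + card {k \<in> {1..m}. \<pi> k \<le> i}"
  using length_blocks[of m \<pi> i] range by (simp del: upt_Suc)

lemma length_queue_order: "length L = Suc n"
proof -
  have "{k \<in> {1..m}. \<pi> k \<le> Suc n} = {1..m}"
    using range by fastforce
  then show ?thesis
    using length_prefix[of "Suc n"] m_le_n by (simp add: queue_order_def del: upt_Suc)
qed

lemma distinct_queue_order: "distinct L"
  by (rule card_distinct) (simp add: set_queue_order length_queue_order card_vertices m_le_n)

text \<open>For \<open>i \<le> n - m\<close> the roots alone suffice; for larger \<open>i\<close> this is the parking condition.\<close>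

lemma progress:
  assumes "i \<le> n"
  shows "i < length (map Root [1..<n - m + 2] @ concat (map (block m \<pi>) [1..<Suc i]))"
proof (cases "i \<le> n - m")
  case False
  then have "card {k \<in> {1..m}. \<pi> k \<le> i} \<ge> m + i - n"
    using parking assms by (auto simp: parking_functions_def)
  then show ?thesis
    unfolding length_prefix using False m_le_n by simp
qed (simp add: length_prefix del: upt_Suc)

definition vertex_parent :: "nat \<Rightarrow> vertex" where
  "vertex_parent i = L ! (\<pi> i - 1)"

definition index :: "vertex \<Rightarrow> nat" where
  "index v = length (takeWhile (\<lambda>u. u \<noteq> v) L)"

text \<open>With \<open>\<pi> i = j + 1\<close> the parent is at position \<open>j\<close>, counted from \<open>0\<close>, and \<open>i\<close> comes after the roots and the
first \<open>j\<close> blocks, which fill more than \<open>j\<close> places.\<close>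

lemma index_parent_less:
  assumes "i \<in> {1..m}"
  shows "index (vertex_parent i) < index (Node i)"
proof -
  define j where "j = \<pi> i - 1"
  have j: "\<pi> i = Suc j" "j < n"
    using range[OF assms] by (auto simp: j_def)
  let ?P = "map Root [1..<n - m + 2] @ concat (map (block m \<pi>) [1..<Suc j])"
  have "L = ?P @ concat (map (block m \<pi>) [Suc j..<n + 2])"
    using j(2) upt_add_eq_append[of 1 "Suc j" "n + 2 - Suc j"]
    by (simp add: queue_order_def del: upt_Suc)
  moreover have "Node i \<notin> set ?P"
    using j by (auto simp: set_block simp del: upt_Suc)
  ultimately have "length ?P \<le> index (Node i)"
    using length_le_takeWhile_neq by (simp only: index_def)
  moreover have "index (vertex_parent i) = j"
    using j length_takeWhile_neq_nth[OF distinct_queue_order, of j]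
    by (simp add: index_def vertex_parent_def length_queue_order)
  ultimately show ?thesis
    using progress[of j] j by linarith
qed

sublocale parent_map m n vertex_parent index
proof
  show "vertex_parent i \<in> vertices m n" if "i \<in> {1..m}" for i
    using range[OF that] nth_mem[of "\<pi> i - 1" L]
    by (auto simp: vertex_parent_def set_queue_order length_queue_order)
qed (rule index_parent_less)

sublocale rooted_forest m n edges
  by unfold_locales (rule m_le_n edges_rooted_forest)+

lemma children_queue_order:
  assumes "j < length L"
  shows "ordered_children m n edges (L ! j) = block m \<pi> (Suc j)"
proof -
  have "L ! j = L ! (\<pi> i - 1) \<longleftrightarrow> \<pi> i = Suc j" if "i \<in> {1..m}" for i
    using range[OF that] assms nth_eq_iff_index_eq[OF distinct_queue_order, of j "\<pi> i - 1"]
    by (auto simp: length_queue_order)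
  then have "{i. is_child m n edges (L ! j) (Node i)} = {i \<in> {1..m}. \<pi> i = Suc j}"
    unfolding is_child_edges_iff vertex_parent_def by auto
  then show ?thesis
    by (simp add: ordered_children_def block_def)
qed

lemma bfs_order_edges: "bfs_order m n edges = L"
proof (rule queue_equation_unique[OF bfs_order_queue])
  show "L = map Root [1..<n - m + 2] @ concat (map (ordered_children m n edges) L)"
    using map_take_positions[where f = "ordered_children m n edges" and g = "block m \<pi>"
        and xs = L and i = "length L"] children_queue_order
    by (simp add: length_queue_order queue_order_def[of m n \<pi>, symmetric] del: upt_Suc)
       (simp add: queue_order_def del: upt_Suc)
qed (use bfs_order_progress in \<open>simp_all add: length_bfs_order length_queue_order\<close>)

lemma bfs_map_edges: "bfs_map m n edges = \<pi>"
proof (rule extensionalityI)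
  fix i assume i: "i \<in> {1..m}"
  have "bfs_map m n edges i = bfs_position m n edges (bfs_order m n edges ! (\<pi> i - 1))"
    using i by (simp add: bfs_map_apply parent_edges vertex_parent_def bfs_order_edges)
  then show "bfs_map m n edges i = \<pi> i"
    using bfs_position_nth[of "\<pi> i - 1"] range[OF i] by auto
qed (use parking in \<open>auto simp: bfs_map_def parking_functions_def PiE_def\<close>)

end

lemma bij_betw_bfs_map:
  assumes "m \<le> n"
  shows "bij_betw (bfs_map m n) (rooted_forests m n) (parking_functions m n)"
  unfolding bij_betw_def
proof (intro conjI equalityI subsetI)
  fix \<pi> assume "\<pi> \<in> parking_functions m n"
  then interpret parking_function m n \<pi>
    using assms by unfold_locales
  show "\<pi> \<in> bfs_map m n ` rooted_forests m n"
    using bfs_map_edges edges_rooted_forest by force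
next
  fix \<pi> assume "\<pi> \<in> bfs_map m n ` rooted_forests m n"
  then show "\<pi> \<in> parking_functions m n"
    using assms rooted_forest.bfs_map_parking by (auto simp: rooted_forest_def)
qed (rule inj_on_bfs_map[OF assms])

section \<open>Equidistribution\<close>

lemma equidistributed_bij_betw:
  assumes bij: "bij_betw f B A" and "\<And>b. b \<in> B \<Longrightarrow> s (f b) = t b"
  shows "equidistributed A s B t"
  unfolding equidistributed_def
proof
  fix c
  have "bij_betw f {b \<in> B. t b = c} {a \<in> A. s a = c}"
    using assms by (force simp: bij_betw_def inj_on_def)
  then show "card {a \<in> A. s a = c} = card {b \<in> B. t b = c}"
    by (simp add: bij_betw_same_card)
qed

theorem theorem3p1:
  fixes m n :: nat
  assumes "1 \<le> m" and "m \<le> n"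
  shows "bij_betw (bfs_map m n) (rooted_forests m n) (parking_functions m n) \<and>
    (\<forall>F \<in> rooted_forests m n. \<forall>\<pi>. \<pi> = bfs_map m n F \<longrightarrow>
       (\<forall>i\<in>{1..m}. occurrences m \<pi> (\<pi> i) = forest_degree m n F (parent m n F (Node i))) \<and>
       (\<forall>j\<in>{1..n - m + 1}. occurrences m \<pi> j = forest_degree m n F (Root j))) \<and>
    (\<forall>i\<in>{1..m}. equidistributed
       (parking_functions m n) (\<lambda>\<pi>. occurrences m \<pi> (\<pi> i))
       (rooted_forests m n) (\<lambda>F. forest_degree m n F (parent m n F (Node i)))) \<and>
    (\<forall>j\<in>{1..n - m + 1}. equidistributed
       (parking_functions m n) (\<lambda>\<pi>. occurrences m \<pi> j)
       (rooted_forests m n) (\<lambda>F. forest_degree m n F (Root j))) \<and>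
    equidistributed
      (parking_functions m n)
      (\<lambda>\<pi>. ((\<lambda>i\<in>{1..m}. occurrences m \<pi> (\<pi> i)),
            (\<lambda>j\<in>{1..n - m + 1}. occurrences m \<pi> j)))
      (rooted_forests m n)
      (\<lambda>F. ((\<lambda>i\<in>{1..m}. forest_degree m n F (parent m n F (Node i))),
            (\<lambda>j\<in>{1..n - m + 1}. forest_degree m n F (Root j))))"
proof -
  note bij = bij_betw_bfs_map[OF \<open>m \<le> n\<close>]
  have siblings: "occurrences m (bfs_map m n F) (bfs_map m n F i)
      = forest_degree m n F (parent m n F (Node i))"
    if "F \<in> rooted_forests m n" "i \<in> {1..m}" for F i
  proof -
    interpret rooted_forest m n F
      using assms that by unfold_locales
    show ?thesis
      using that by (simp add: bfs_map_apply occurrences_bfs_position parent_in_vertices)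
  qed
  have at_root: "occurrences m (bfs_map m n F) j = forest_degree m n F (Root j)"
    if "F \<in> rooted_forests m n" "j \<in> {1..n - m + 1}" for F j
  proof -
    interpret rooted_forest m n F
      using assms that by unfold_locales
    have "Root j \<in> vertices m n"
      using that by (auto simp: vertices_def roots_def)
    then show ?thesis
      using occurrences_bfs_position bfs_position_Root that by metis
  qed
  show ?thesis
    using bij siblings at_root
    by (intro conjI ballI allI impI equidistributed_bij_betw[OF bij])
       (auto intro!: restrict_ext)
qed

end
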